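(* Let $f:(0,\infty)\to\mathbb{R}$ be a twice differentiable convex function with $f(1)=0$. Let $\mathcal{D}$ and $\mathcal{W}$ be subsets of Euclidean spaces and let $\mathsf{K}:\mathcal{D}\to\mathcal{P}(\mathcal{W})$ be a Markov kernel. Then for any probability measures $\mu,\nu\in\mathcal{P}(\mathcal{D})$, $$D_f(\mu\mathsf{K}\|\nu\mathsf{K})\le\int_1^\infty\eta_\gamma(\mathsf{K})\Big[f''(\gamma)\,\mathsf{E}_\gamma(\mu\|\nu)+\gamma^{-3}f''(\gamma^{-1})\,\mathsf{E}_\gamma(\nu\|\mu)\Big]\,d\gamma.$$
   Context: $\mathcal{P}(\cdot)$ denotes the set of probability measures on a set. For $\gamma\ge1$ and probability measures $\mu,\nu$ on the same space, $\mathsf{E}_\gamma(\mu\|\nu)=\sup_{A}[\mu(A)-\gamma\nu(A)]$ over measurable $A$. For $\mu\in\mathcal{P}(\mathcal{D})$, $\mu\mathsf{K}=\int\mu(dx)\,\mathsf{K}(\cdot|x)$. The contraction coefficient is $\eta_\gamma(\mathsf{K})=\sup\left\{\frac{\mathsf{E}_\gamma(\mu\mathsf{K}\|\nu\mathsf{K})}{\mathsf{E}_\gamma(\mu\|\nu)}:\mu,\nu\in\mathcal{P}(\mathcal{D}),\ \mathsf{E}_\gamma(\mu\|\nu)\ne0\right\}$ (the supremum of the empty set being $0$). For $\mu\ll\nu$, the $f$-divergence is $D_f(\mu\|\nu)=\mathbb{E}_\nu\left[f\left(\frac{d\mu}{d\nu}\right)\right]$ with $f(0)=\lim_{t\to0^+}f(t)$;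 in general, writing $p,q$ for densities of $\mu,\nu$ with respect to a common dominating measure, $D_f(\mu\|\nu)=\int_{\{q>0\}}q\,f(p/q)+\big(\lim_{t\to\infty}f(t)/t\big)\,\mu(q=0)$ (with $0\cdot\infty=0$). Both sides of the inequality may be $+\infty$. *)

theory Defs
  imports "HOL-Probability.Probability"
begin

text \<open>For probability measures and \<open>\<gamma> \<ge> 0\<close> the set over which the supremum is taken is bounded above by 1,
  and it contains 0 (empty event), so the conditionally complete real supremum is the intended one.\<close>

definition E_div :: "real \<Rightarrow> 'a measure \<Rightarrow> 'a measure \<Rightarrow> real" where
  "E_div \<gamma> \<mu> \<nu> = (SUP A\<in>sets \<mu>. measure \<mu> A - \<gamma> * measure \<nu> A)"

text \<open>A Markov kernel from \<open>M\<close> to \<open>N\<close> is an element of \<open>M \<rightarrow>\<^sub>M prob_algebra N\<close>, the probability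
  measures on \<open>M\<close> are the elements of \<open>space (prob_algebra M)\<close>, and \<open>\<mu>K\<close> is the Giry bind
  \<open>\<mu> \<bind> K\<close>. The supremum is taken in \<^typ>\<open>ennreal\<close>, where the empty supremum is 0.\<close>

definition contraction_coeff :: "real \<Rightarrow> 'a measure \<Rightarrow> ('a \<Rightarrow> 'b measure) \<Rightarrow> ennreal" where
  "contraction_coeff \<gamma> M K =
     (SUP (\<mu>, \<nu>) \<in> {(\<mu>, \<nu>). \<mu> \<in> space (prob_algebra M) \<and> \<nu> \<in> space (prob_algebra M) \<and>
                           E_div \<gamma> \<mu> \<nu> \<noteq> 0}.
        ennreal (E_div \<gamma> (\<mu> \<bind> K) (\<nu> \<bind> K) / E_div \<gamma> \<mu> \<nu>))"

text \<open>The integral of an extended-real function whose negative part has a finite integral;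
  the value may be \<open>\<infinity>\<close>.\<close>

definition ereal_integral :: "'a measure \<Rightarrow> ('a \<Rightarrow> ereal) \<Rightarrow> ereal" where
  "ereal_integral M g =
     enn2ereal (\<integral>\<^sup>+x. e2ennreal (g x) \<partial>M) - enn2ereal (\<integral>\<^sup>+x. e2ennreal (- g x) \<partial>M)"

definition at_zero_ext :: "(real \<Rightarrow> real) \<Rightarrow> real \<Rightarrow> ereal" where
  "at_zero_ext f t = (if t = 0 then Lim (at_right 0) (\<lambda>s. ereal (f s)) else ereal (f t))"

definition slope_at_infinity :: "(real \<Rightarrow> real) \<Rightarrow> ereal" where
  "slope_at_infinity f = Lim at_top (\<lambda>t. ereal (f t / t))"

definition add_measure :: "'a measure \<Rightarrow> 'a measure \<Rightarrow> 'a measure" where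
  "add_measure \<mu> \<nu> = measure_of (space \<mu>) (sets \<mu>) (\<lambda>A. emeasure \<mu> A + emeasure \<nu> A)"

text \<open>The \<open>f\<close>-divergence does not depend on the dominating measure or on the versions of the
  densities; we take \<open>\<mu> + \<nu>\<close> as dominating measure. For convex \<open>f\<close> on the positive reals with
  \<open>f 1 = 0\<close> both limits exist in \<open>(-\<infinity>, \<infinity>]\<close> and the negative part of the integrand is integrable
  (\<open>f\<close> lies above a supporting line at 1), so no \<open>\<infinity> - \<infinity>\<close> arises. In \<^typ>\<open>ereal\<close>, \<open>\<infinity> * 0 = 0\<close>.\<close>

definition f_divergence :: "(real \<Rightarrow> real) \<Rightarrow> 'a measure \<Rightarrow> 'a measure \<Rightarrow> ereal" where
  "f_divergence f \<mu> \<nu> =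
     (let S = add_measure \<mu> \<nu>;
          p = (\<lambda>x. enn2real (RN_deriv S \<mu> x));
          q = (\<lambda>x. enn2real (RN_deriv S \<nu> x))
      in ereal_integral S (\<lambda>x. if q x > 0 then ereal (q x) * at_zero_ext f (p x / q x) else 0)
         + slope_at_infinity f * ereal (measure \<mu> {x \<in> space \<mu>. q x = 0}))"

end

theory Submission
  imports Defs
begin

text \<open>
  Taylor's formula with integral remainder at 1, in perspective form, writes \<open>q f(p/q) - f'(1) (p - q)\<close>,
  for densities \<open>p, q\<close>, as the integral over \<open>\<gamma> \<ge> 1\<close> of
  \<open>f''(\<gamma>) max 0 (p - \<gamma> q) + f''(1/\<gamma>) / \<gamma>^3 max 0 (q - \<gamma> p)\<close>.
  For \<open>p = 0\<close> or \<open>q = 0\<close> only \<open>\<le>\<close> is needed; it follows by approximation from the positive case, since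
  the remainder is monotone there. Integrating over the space, the linear term cancels, and Tonelli's
  theorem turns \<open>max 0 (p - \<gamma> q)\<close> into \<open>E_div\<close>. For \<open>\<mu>K\<close> and \<open>\<nu>K\<close> this leaves the contraction of \<open>E_div\<close>
  at each single \<open>\<gamma>\<close>, so measurability of the contraction coefficient in \<open>\<gamma>\<close> plays no role.
\<close>

section \<open>Measurability of derivatives and one-sided limits at 0\<close>

text \<open>A derivative is the pointwise limit of difference quotients with steps 1/(n+1), each of
  them Borel because \<open>g\<close> is continuous on the open half-line. Applied to
  \<open>deriv f\<close>, this makes \<open>f2\<close> measurable although it may be
  discontinuous.\<close>

lemma borel_measurable_deriv_Ioi:
  fixes g :: "real \<Rightarrow> real"
  assumes "\<And>x. x > 0 \<Longrightarrow> g differentiable at x"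
  shows "(\<lambda>x. indicator {0<..} x * deriv g x) \<in> borel_measurable borel"
proof -
  \<comment> \<open>Cutting off with the indicator gives a Borel function on the whole line. The
    steps are positive, so for x > 0 the quotients see only points where \<open>h\<close> equals
    \<open>g\<close>.\<close>
  define h where "h x = indicator {0<..} x *\<^sub>R g x" for x
  have "continuous_on {0<..} g"
    using assms differentiable_imp_continuous_within
    by (intro continuous_at_imp_continuous_on) auto
  then have [measurable]: "h \<in> borel_measurable borel"
    unfolding h_def by (intro borel_measurable_continuous_on_indicator) auto
  show ?thesis
  proof (rule borel_measurable_LIMSEQ_real)
    show "(\<lambda>n. indicator {0<..} x * ((h (x + inverse (real (Suc n))) - h x) / inverse (real (Suc n))))
        \<longlonglongrightarrow> indicator {0<..} x * deriv g x" for x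
    proof (cases "x > 0")
      case True
      then have "(g has_real_derivative deriv g x) (at x)"
        using assms DERIV_deriv_iff_real_differentiable by blast
      then have "((\<lambda>e. (g (x + e) - g x) / e) \<longlongrightarrow> deriv g x) (at 0)"
        by (simp add: DERIV_def)
      moreover have "filterlim (\<lambda>n. inverse (real (Suc n))) (at 0) sequentially"
        unfolding filterlim_at using LIMSEQ_inverse_real_of_nat by auto
      ultimately have "(\<lambda>n. (g (x + inverse (real (Suc n))) - g x) / inverse (real (Suc n)))
          \<longlonglongrightarrow> deriv g x"
        by (rule filterlim_compose)
      moreover have "h (x + inverse (real (Suc n))) = g (x + inverse (real (Suc n)))" for n
      proof -
        have "x + inverse (real (Suc n)) > 0"
          using True by (intro add_pos_pos) auto
        then show ?thesis
          by (simp add: h_def)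
      qed
      moreover have "h x = g x"
        using True by (simp add: h_def)
      ultimately show ?thesis
        using True by (simp del: of_nat_Suc)
    qed auto
  qed measurable
qed

text \<open>\<open>Lim\<close> has a usable value only once convergence is known. The antitone part
  \<open>k\<close> converges to its supremum on (0,1], possibly \<infinity>, and \<open>v\<close>
  converges to a real. This serves both boundary terms of the divergence: f(0+) directly, and the
  limit of f(t)/t after t = 1/s.\<close>

lemma Lim_at_right_0_le:
  fixes f k v :: "real \<Rightarrow> real"
  assumes anti: "\<And>s t. 0 < s \<Longrightarrow> s \<le> t \<Longrightarrow> t \<le> 1 \<Longrightarrow> k t \<le> k s"
    and le: "\<And>s. 0 < s \<Longrightarrow> s \<le> 1 \<Longrightarrow> ereal (k s) \<le> B"
    and v: "(v \<longlongrightarrow> l) (at_right 0)"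
    and f: "\<And>s. 0 < s \<Longrightarrow> f s = k s + v s"
  shows "Lim (at_right 0) (\<lambda>s. ereal (f s)) \<le> B + ereal l"
proof -
  let ?S = "SUP s\<in>{0<..1}. ereal (k s)"
  have ev: "eventually (\<lambda>s. 0 < s \<and> s \<le> t) (at_right 0)" if "t > 0" for t :: real
    using that by (auto simp: eventually_at_right_field intro!: exI[of _ t])
  have "((\<lambda>s. ereal (k s)) \<longlongrightarrow> ?S) (at_right 0)"
  proof (rule increasing_tendsto)
    show "eventually (\<lambda>s. ereal (k s) \<le> ?S) (at_right 0)"
      using ev[OF zero_less_one] by eventually_elim (auto intro: SUP_upper)
    fix y assume "y < ?S"
    then obtain t where t: "0 < t" "t \<le> 1" "y < ereal (k t)"
      by (auto simp: less_SUP_iff)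
    show "eventually (\<lambda>s. y < ereal (k s)) (at_right 0)"
      using ev[OF t(1)]
    proof eventually_elim
      case (elim s)
      then have "ereal (k t) \<le> ereal (k s)"
        using anti[of s t] t by simp
      with t(3) show ?case
        by (rule less_le_trans)
    qed
  qed
  \<comment> \<open>The limit \<open>l\<close> is finite, so adding the two limits is legitimate
    even if \<open>?S\<close> is \<infinity>.\<close>
  then have "((\<lambda>s. ereal (k s) + ereal (v s)) \<longlongrightarrow> ?S + ereal l) (at_right 0)"
    using v by (intro tendsto_add_ereal_general1) auto
  moreover have "eventually (\<lambda>s. ereal (k s) + ereal (v s) = ereal (f s)) (at_right 0)"
    using ev[OF zero_less_one] by eventually_elim (auto simp: f)
  ultimately have "((\<lambda>s. ereal (f s)) \<longlongrightarrow> ?S + ereal l) (at_right 0)"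
    using tendsto_cong by fastforce
  then have "Lim (at_right 0) (\<lambda>s. ereal (f s)) = ?S + ereal l"
    by (intro tendsto_Lim) auto
  moreover have "?S \<le> B"
    using le by (auto intro: SUP_least)
  ultimately show ?thesis
    by (simp add: add_right_mono)
qed

section \<open>The Taylor remainder in perspective form\<close>

locale convex_generator =
  fixes f :: "real \<Rightarrow> real"
  assumes diff: "\<And>x. x > 0 \<Longrightarrow> f differentiable at x"
    and diff2: "\<And>x. x > 0 \<Longrightarrow> deriv f differentiable at x"
    and convex: "convex_on {0<..} f"
    and f_1: "f 1 = 0"
begin

abbreviation "f1 \<equiv> deriv f"
abbreviation "f2 \<equiv> deriv (deriv f)"

lemma has_deriv_f: "x > 0 \<Longrightarrow> (f has_real_derivative f1 x) (at x)"
  using diff DERIV_deriv_iff_real_differentiable by blast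

lemma has_deriv_f1: "x > 0 \<Longrightarrow> (f1 has_real_derivative f2 x) (at x)"
  using diff2 DERIV_deriv_iff_real_differentiable by blast

text \<open>A convex graph lies above its tangents. Adding the tangent inequalities at two points
  shows that \<open>f1\<close> is nondecreasing, hence its derivative is nonnegative.\<close>

lemma f2_nonneg: "f2 x \<ge> 0" if "x > 0"
proof -
  have tangent: "f y - f z \<ge> f1 z * (y - z)" if "y > 0" "z > 0" for y z
    using that convex_on_imp_above_tangent[OF convex, of z y "f1 z"]
    by (auto simp: interior_open has_deriv_f has_field_derivative_at_within)
  have "f1 y \<le> f1 z" if "0 < y" "y \<le> z" for y z
  proof (cases "y = z")
    case False
    have "f1 y * (z - y) \<le> f1 z * (z - y)"
      using tangent[of z y] tangent[of y z] that by (simp add: algebra_simps)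
    with that False show ?thesis
      by simp
  qed auto
  then have "mono_on {0<..} f1"
    by (auto intro: mono_onI)
  then show ?thesis
    using that by (intro mono_on_imp_deriv_nonneg[OF _ has_deriv_f1]) (auto simp: interior_open)
qed

text \<open>The indicator builds the range \<gamma> \<ge> 1 into the weight, so that all later
  integrals run over the whole of \<open>lborel\<close>.\<close>

definition weight :: "real \<Rightarrow> real" where
  "weight \<gamma> = indicator {1..} \<gamma> * f2 \<gamma>"

text \<open>The part of the remainder below 1, the integral of f''(t) (t q - p) over p/q \<le> t
  \<le> 1, is moved to \<gamma> \<ge> 1 by t = 1/\<gamma>. The differential contributes \<gamma>^2
  to the denominator, and q/\<gamma> - p = (q - \<gamma> p)/\<gamma> contributes the third
  power.\<close>

definition weight' :: "real \<Rightarrow> real" where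
  "weight' \<gamma> = indicator {1..} \<gamma> * (f2 (1 / \<gamma>) / \<gamma> ^ 3)"

lemma weight_nonneg [simp]: "weight \<gamma> \<ge> 0" "weight' \<gamma> \<ge> 0"
  using f2_nonneg[of \<gamma>] f2_nonneg[of "1 / \<gamma>"] by (auto simp: weight_def weight'_def indicator_def)

lemma measurable_weight [measurable]:
  "weight \<in> borel_measurable borel" "weight' \<in> borel_measurable borel"
proof -
  have [measurable]: "(\<lambda>x. indicator {0<..} x * f2 x) \<in> borel_measurable borel"
    using diff2 by (rule borel_measurable_deriv_Ioi)
  have "(\<lambda>x. indicator {1..} x * (indicator {0<..} x * f2 x)) \<in> borel_measurable borel"
    by measurable
  also have "(\<lambda>x. indicator {1..} x * (indicator {0<..} x * f2 x)) = weight"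
    by (auto simp: weight_def indicator_def)
  finally show "weight \<in> borel_measurable borel" .
  have "(\<lambda>x. indicator {0<..} (1 / x) * f2 (1 / x)) \<in> borel_measurable borel"
    by (rule measurable_compose[of "\<lambda>x. 1 / x" borel borel "\<lambda>x. indicator {0<..} x * f2 x"]) measurable
  then have "(\<lambda>x. indicator {1..} x * (indicator {0<..} (1 / x) * f2 (1 / x)) / x ^ 3)
      \<in> borel_measurable borel"
    by measurable
  also have "(\<lambda>x. indicator {1..} x * (indicator {0<..} (1 / x) * f2 (1 / x)) / x ^ 3) = weight'"
    by (auto simp: weight'_def indicator_def)
  finally show "weight' \<in> borel_measurable borel" .
qed

text \<open>This is the remainder of q f(p/q) after its linear term. Written as an
  \<open>ennreal\<close> integral it also makes sense, possibly with value \<infinity>, when p or q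
  is 0.\<close>

definition density_gap :: "real \<Rightarrow> real \<Rightarrow> ennreal" where
  "density_gap p q = (\<integral>\<^sup>+\<gamma>. ennreal (weight \<gamma> * max 0 (p - \<gamma> * q) + weight' \<gamma> * max 0 (q - \<gamma> * p)) \<partial>lborel)"

text \<open>Homogeneity reduces the boundary cases p = 0 and q = 0 to the two values
  \<open>density_gap 0 1\<close> and \<open>density_gap 1 0\<close>.\<close>

lemma density_gap_cmult: "density_gap (t * p) (t * q) = ennreal t * density_gap p q" if "t \<ge> 0"
proof -
  have "max 0 (t * a - \<gamma> * (t * b)) = t * max 0 (a - \<gamma> * b)" for \<gamma> a b
    using that by (simp add: max_mult_distrib_left algebra_simps)
  then show ?thesis
    unfolding density_gap_def using that
    by (subst nn_integral_cmult[symmetric]) (auto simp: algebra_simps simp flip: ennreal_mult')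
qed

text \<open>Both weights vanish below 1, so comparing the truncations for \<gamma> \<ge> 1 is
  enough. The comparisons used later can fail for smaller \<gamma>.\<close>

lemma density_gap_mono:
  assumes "\<And>\<gamma>. \<gamma> \<ge> 1 \<Longrightarrow> max 0 (p - \<gamma> * q) \<le> max 0 (p' - \<gamma> * q')"
    and "\<And>\<gamma>. \<gamma> \<ge> 1 \<Longrightarrow> max 0 (q - \<gamma> * p) \<le> max 0 (q' - \<gamma> * p')"
  shows "density_gap p q \<le> density_gap p' q'"
  unfolding density_gap_def
proof (intro nn_integral_mono ennreal_leI)
  fix \<gamma> :: real
  show "weight \<gamma> * max 0 (p - \<gamma> * q) + weight' \<gamma> * max 0 (q - \<gamma> * p)
      \<le> weight \<gamma> * max 0 (p' - \<gamma> * q') + weight' \<gamma> * max 0 (q' - \<gamma> * p')"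
  proof (cases "\<gamma> \<ge> 1")
    case True
    then show ?thesis
      using assms by (intro add_mono mult_left_mono) auto
  qed (auto simp: weight_def weight'_def)
qed

text \<open>Depending on whether p \<ge> q, one of the two truncations vanishes for all \<gamma>
  \<ge> 1, and the other is supported up to p/q or q/p. The fundamental theorem of calculus
  evaluates what remains. Nonnegativity is recorded as well, since \<open>ennreal\<close> would
  truncate a negative value.\<close>

lemma density_gap_eq:
  assumes "p > 0" "q > 0"
  shows "density_gap p q = ennreal (q * f (p / q) - f1 1 * (p - q))"
    and "q * f (p / q) - f1 1 * (p - q) \<ge> 0"
proof -
  have "density_gap p q = ennreal (q * f (p / q) - f1 1 * (p - q)) \<and>
      q * f (p / q) - f1 1 * (p - q) \<ge> 0"
  proof (cases "p \<ge> q")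
    case True
    \<comment> \<open>Integration by parts of f''(\<gamma>) (p - \<gamma> q) yields this
      antiderivative. At p/q its first summand vanishes; at 1 the second does, because f(1) =
      0.\<close>
    define F where "F \<gamma> = f1 \<gamma> * (p - \<gamma> * q) + q * f \<gamma>" for \<gamma>
    have le: "1 \<le> p / q"
      using True assms by simp
    have D: "(F has_real_derivative weight \<gamma> * (p - \<gamma> * q)) (at \<gamma>)" if "1 \<le> \<gamma>" for \<gamma>
      unfolding F_def using that
      by (auto intro!: derivative_eq_intros has_deriv_f has_deriv_f1 simp: weight_def algebra_simps)
    have nn: "weight \<gamma> * (p - \<gamma> * q) \<ge> 0" if "\<gamma> \<le> p / q" for \<gamma>
      using that assms by (intro mult_nonneg_nonneg) (auto simp: field_simps)
    have F: "F (p / q) - F 1 = q * f (p / q) - f1 1 * (p - q)"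
      using assms by (simp add: F_def f_1 algebra_simps)
    have "density_gap p q = (\<integral>\<^sup>+\<gamma>. ennreal (weight \<gamma> * (p - \<gamma> * q)) * indicator {1..p / q} \<gamma> \<partial>lborel)"
      unfolding density_gap_def
    proof (rule nn_integral_cong)
      fix \<gamma> :: real
      show "ennreal (weight \<gamma> * max 0 (p - \<gamma> * q) + weight' \<gamma> * max 0 (q - \<gamma> * p)) =
          ennreal (weight \<gamma> * (p - \<gamma> * q)) * indicator {1..p / q} \<gamma>"
      proof (cases "\<gamma> \<ge> 1")
        case g: True
        then have "1 * p \<le> \<gamma> * p"
          using assms by (intro mult_right_mono) auto
        with True have "max 0 (q - \<gamma> * p) = 0"
          by simp
        moreover have "max 0 (p - \<gamma> * q) = (p - \<gamma> * q) * indicator {1..p / q} \<gamma>"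
          using g assms by (auto simp: indicator_def max_def field_simps)
        ultimately show ?thesis
          by (auto simp: indicator_def)
      qed (auto simp: weight_def weight'_def)
    qed
    also have "\<dots> = ennreal (F (p / q) - F 1)"
      using D nn le by (intro nn_integral_FTC_Icc) (auto intro: has_field_derivative_at_within)
    finally show ?thesis
      using DERIV_nonneg_imp_nondecreasing[OF le, of F] D nn F by force
  next
    case False
    \<comment> \<open>The same integration by parts in the variable t = 1/\<gamma>. At \<gamma> =
      q/p the factor of \<open>f1\<close> vanishes, and at \<gamma> = 1 the term with
      \<open>f\<close> does.\<close>
    define F where "F \<gamma> = q * f (1 / \<gamma>) - f1 (1 / \<gamma>) * (q / \<gamma> - p)" for \<gamma>
    have le: "1 \<le> q / p"
      using False assms by simp
    have D: "(F has_real_derivative weight' \<gamma> * (q - \<gamma> * p)) (at \<gamma>)" if "1 \<le> \<gamma>" for \<gamma>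
    proof -
      have "((\<lambda>x. f (1 / x)) has_real_derivative f1 (1 / \<gamma>) * (- 1 / \<gamma>\<^sup>2)) (at \<gamma>)"
        using that by (intro DERIV_chain2[OF has_deriv_f])
          (auto intro!: derivative_eq_intros simp: power2_eq_square)
      moreover have "((\<lambda>x. f1 (1 / x)) has_real_derivative f2 (1 / \<gamma>) * (- 1 / \<gamma>\<^sup>2)) (at \<gamma>)"
        using that by (intro DERIV_chain2[OF has_deriv_f1])
          (auto intro!: derivative_eq_intros simp: power2_eq_square)
      moreover have "((\<lambda>x. q / x - p) has_real_derivative q * (- 1 / \<gamma>\<^sup>2)) (at \<gamma>)"
        using that by (auto intro!: derivative_eq_intros simp: power2_eq_square)
      ultimately have "(F has_real_derivative q * (f1 (1 / \<gamma>) * (- 1 / \<gamma>\<^sup>2)) -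
          (f2 (1 / \<gamma>) * (- 1 / \<gamma>\<^sup>2) * (q / \<gamma> - p) + q * (- 1 / \<gamma>\<^sup>2) * f1 (1 / \<gamma>))) (at \<gamma>)"
        unfolding F_def by (intro DERIV_diff DERIV_cmult DERIV_mult)
      moreover have "q * (f1 (1 / \<gamma>) * (- 1 / \<gamma>\<^sup>2)) -
          (f2 (1 / \<gamma>) * (- 1 / \<gamma>\<^sup>2) * (q / \<gamma> - p) + q * (- 1 / \<gamma>\<^sup>2) * f1 (1 / \<gamma>))
          = weight' \<gamma> * (q - \<gamma> * p)"
        using that by (simp add: weight'_def field_simps power2_eq_square power3_eq_cube)
      ultimately show ?thesis
        by simp
    qed
    have nn: "weight' \<gamma> * (q - \<gamma> * p) \<ge> 0" if "\<gamma> \<le> q / p" for \<gamma>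
      using that assms by (intro mult_nonneg_nonneg) (auto simp: field_simps)
    have F: "F (q / p) - F 1 = q * f (p / q) - f1 1 * (p - q)"
      using assms by (simp add: F_def f_1 algebra_simps)
    have "density_gap p q = (\<integral>\<^sup>+\<gamma>. ennreal (weight' \<gamma> * (q - \<gamma> * p)) * indicator {1..q / p} \<gamma> \<partial>lborel)"
      unfolding density_gap_def
    proof (rule nn_integral_cong)
      fix \<gamma> :: real
      show "ennreal (weight \<gamma> * max 0 (p - \<gamma> * q) + weight' \<gamma> * max 0 (q - \<gamma> * p)) =
          ennreal (weight' \<gamma> * (q - \<gamma> * p)) * indicator {1..q / p} \<gamma>"
      proof (cases "\<gamma> \<ge> 1")
        case g: True
        then have "1 * q \<le> \<gamma> * q"
          using assms by (intro mult_right_mono) auto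
        with False have "max 0 (p - \<gamma> * q) = 0"
          by simp
        moreover have "max 0 (q - \<gamma> * p) = (q - \<gamma> * p) * indicator {1..q / p} \<gamma>"
          using g assms by (auto simp: indicator_def max_def field_simps)
        ultimately show ?thesis
          by (auto simp: indicator_def)
      qed (auto simp: weight_def weight'_def)
    qed
    also have "\<dots> = ennreal (F (q / p) - F 1)"
      using D nn le by (intro nn_integral_FTC_Icc) (auto intro: has_field_derivative_at_within)
    finally show ?thesis
      using DERIV_nonneg_imp_nondecreasing[OF le, of F] D nn F by force
  qed
  then show "density_gap p q = ennreal (q * f (p / q) - f1 1 * (p - q))"
    and "q * f (p / q) - f1 1 * (p - q) \<ge> 0"
    by auto
qed

section \<open>Boundary values at p = 0 and q = 0\<close>

text \<open>After subtracting the tangent at 1, the value at s is \<open>density_gap s 1\<close>,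
  which grows as s decreases to 0 and stays below \<open>density_gap 0 1\<close>. The tangent itself
  tends to \<open>- f1 1\<close>.\<close>

lemma Lim_f_at_0_le:
  "Lim (at_right 0) (\<lambda>s. ereal (f s)) \<le> enn2ereal (density_gap 0 1) + ereal (- f1 1)"
proof (rule Lim_at_right_0_le[where k = "\<lambda>s. f s - f1 1 * (s - 1)" and v = "\<lambda>s. f1 1 * (s - 1)"])
  have k: "density_gap s 1 = ennreal (f s - f1 1 * (s - 1))" "f s - f1 1 * (s - 1) \<ge> 0"
    if "s > 0" for s
    using density_gap_eq[of s 1] that by auto
  \<comment> \<open>For \<gamma> \<ge> 1 and s, t \<le> 1 the truncations of t - \<gamma> and s -
    \<gamma> are both 0, so only the other pair has to be compared.\<close>
  have mono: "density_gap t 1 \<le> density_gap s 1" if "0 \<le> s" "s \<le> t" "t \<le> 1" for s t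
  proof (rule density_gap_mono)
    fix \<gamma> :: real assume "\<gamma> \<ge> 1"
    with that have "\<gamma> * s \<le> \<gamma> * t"
      by (intro mult_left_mono) auto
    with that \<open>\<gamma> \<ge> 1\<close> show "max 0 (t - \<gamma> * 1) \<le> max 0 (s - \<gamma> * 1)" "max 0 (1 - \<gamma> * t) \<le> max 0 (1 - \<gamma> * s)"
      by linarith+
  qed
  show "f t - f1 1 * (t - 1) \<le> f s - f1 1 * (s - 1)" if "0 < s" "s \<le> t" "t \<le> 1" for s t
    using that mono[of s t] k[of s] k[of t] by (simp add: ennreal_le_iff)
  show "ereal (f s - f1 1 * (s - 1)) \<le> enn2ereal (density_gap 0 1)" if "0 < s" "s \<le> 1" for s
    using that mono[of 0 s] k[of s]
    by (simp add: less_eq_ennreal.rep_eq)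
  show "((\<lambda>s. f1 1 * (s - 1)) \<longlongrightarrow> - f1 1) (at_right 0)"
    by (auto intro!: tendsto_eq_intros)
qed auto

text \<open>The substitution t = 1/s turns f(t)/t into s f(1/s), the perspective at p = 1 and q = s.
  The argument at 0 then repeats with the two densities exchanged.\<close>

lemma slope_at_infinity_le:
  "slope_at_infinity f \<le> enn2ereal (density_gap 1 0) + ereal (f1 1)"
proof -
  have "slope_at_infinity f = Lim (at_right 0) (\<lambda>s. ereal (f (inverse s) / inverse s))"
    unfolding slope_at_infinity_def t2_space_class.Lim_def at_top_to_right filterlim_filtermap ..
  also have "\<dots> = Lim (at_right 0) (\<lambda>s. ereal (s * f (1 / s)))"
    by (simp add: divide_inverse mult.commute)
  also have "\<dots> \<le> enn2ereal (density_gap 1 0) + ereal (f1 1)"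
  proof (rule Lim_at_right_0_le[where k = "\<lambda>s. s * f (1 / s) - f1 1 * (1 - s)" and v = "\<lambda>s. f1 1 * (1 - s)"])
    have k: "density_gap 1 s = ennreal (s * f (1 / s) - f1 1 * (1 - s))" "s * f (1 / s) - f1 1 * (1 - s) \<ge> 0"
      if "s > 0" for s
      using density_gap_eq[of 1 s] that by auto
    have mono: "density_gap 1 t \<le> density_gap 1 s" if "0 \<le> s" "s \<le> t" "t \<le> 1" for s t
    proof (rule density_gap_mono)
      fix \<gamma> :: real assume "\<gamma> \<ge> 1"
      with that have "\<gamma> * s \<le> \<gamma> * t"
        by (intro mult_left_mono) auto
      with that \<open>\<gamma> \<ge> 1\<close> show "max 0 (1 - \<gamma> * t) \<le> max 0 (1 - \<gamma> * s)" "max 0 (t - \<gamma> * 1) \<le> max 0 (s - \<gamma> * 1)"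
        by linarith+
    qed
    show "t * f (1 / t) - f1 1 * (1 - t) \<le> s * f (1 / s) - f1 1 * (1 - s)" if "0 < s" "s \<le> t" "t \<le> 1" for s t
      using that mono[of s t] k[of s] k[of t] by (simp add: ennreal_le_iff)
    show "ereal (s * f (1 / s) - f1 1 * (1 - s)) \<le> enn2ereal (density_gap 1 0)" if "0 < s" "s \<le> 1" for s
      using that mono[of 0 s] k[of s]
      by (simp add: less_eq_ennreal.rep_eq)
    show "((\<lambda>s. f1 1 * (1 - s)) \<longlongrightarrow> f1 1) (at_right 0)"
      by (auto intro!: tendsto_eq_intros)
  qed auto
  finally show ?thesis .
qed

text \<open>For p > 0 this is an equality. For p = 0 the bound on f(0+) is multiplied by q and
  homogeneity is applied.\<close>

lemma integrand_le:
  assumes "p \<ge> 0" "q > 0"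
  shows "ereal q * at_zero_ext f (p / q) \<le> enn2ereal (density_gap p q) + ereal (f1 1 * (p - q))"
proof (cases "p = 0")
  case True
  have "ereal q * at_zero_ext f 0 \<le> ereal q * (enn2ereal (density_gap 0 1) + ereal (- f1 1))"
    using assms Lim_f_at_0_le by (intro ereal_mult_left_mono) (auto simp: at_zero_ext_def)
  also have "\<dots> = ereal q * enn2ereal (density_gap 0 1) + ereal (f1 1 * (0 - q))"
    by (cases "enn2ereal (density_gap 0 1)") (use assms in \<open>auto simp: algebra_simps\<close>)
  also have "ereal q * enn2ereal (density_gap 0 1) = enn2ereal (density_gap 0 q)"
    using density_gap_cmult[of q 0 1] assms by (simp add: times_ennreal.rep_eq)
  finally show ?thesis
    using True by simp
next
  case False
  with density_gap_eq[of p q] assms show ?thesis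
    by (simp add: at_zero_ext_def)
qed

end

section \<open>The dominating measure, real densities and extended-real integrals\<close>

lemma
  assumes "sets \<mu> = sets \<nu>"
  shows sets_add_measure: "sets (add_measure \<mu> \<nu>) = sets \<mu>"
    and space_add_measure: "space (add_measure \<mu> \<nu>) = space \<mu>"
    and emeasure_add_measure: "A \<in> sets \<mu> \<Longrightarrow> emeasure (add_measure \<mu> \<nu>) A = emeasure \<mu> A + emeasure \<nu> A"
proof -
  show S: "sets (add_measure \<mu> \<nu>) = sets \<mu>" and "space (add_measure \<mu> \<nu>) = space \<mu>"
    by (auto simp: add_measure_def)
  have "countably_additive (sets \<mu>) (\<lambda>A. emeasure \<mu> A + emeasure \<nu> A)"
  proof (rule countably_additiveI)
    fix A :: "nat \<Rightarrow> 'a set"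
    assume "range A \<subseteq> sets \<mu>" "disjoint_family A"
    then show "(\<Sum>i. emeasure \<mu> (A i) + emeasure \<nu> (A i)) = emeasure \<mu> (\<Union> (range A)) + emeasure \<nu> (\<Union> (range A))"
      using assms by (simp add: suminf_add[symmetric] suminf_emeasure)
  qed
  then show "emeasure (add_measure \<mu> \<nu>) A = emeasure \<mu> A + emeasure \<nu> A" if "A \<in> sets \<mu>"
    using that S sets.sets_into_space[of _ \<mu>]
    by (intro emeasure_measure_of[OF add_measure_def]) (auto simp: positive_def)
qed

text \<open>The Radon-Nikodym derivative of a finite measure is finite almost everywhere, so passing
  to reals changes it only on a null set.\<close>

lemma (in sigma_finite_measure) density_enn2real_RN_deriv:
  assumes "finite_measure N" "absolutely_continuous M N" "sets N = sets M"
  shows "density M (\<lambda>x. ennreal (enn2real (RN_deriv M N x))) = N"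
proof -
  interpret N: finite_measure N by fact
  have "AE x in M. RN_deriv M N x \<noteq> \<infinity>"
    using assms N.sigma_finite_measure_axioms by (intro RN_deriv_finite) auto
  then have "AE x in M. ennreal (enn2real (RN_deriv M N x)) = RN_deriv M N x"
    by eventually_elim (auto simp: less_top)
  then have "density M (\<lambda>x. ennreal (enn2real (RN_deriv M N x))) = density M (RN_deriv M N)"
    by (intro density_cong) auto
  then show ?thesis
    using density_RN_deriv assms by simp
qed

lemma ereal_integral_mono:
  assumes "\<And>x. x \<in> space M \<Longrightarrow> g x \<le> h x"
  shows "ereal_integral M g \<le> ereal_integral M h"
  unfolding ereal_integral_def
  using assms by (intro ereal_minus_mono) (auto simp flip: less_eq_ennreal.rep_eq intro!: nn_integral_mono e2ennreal_mono)

text \<open>Since u \<ge> 0, the negative part of u + v is at most that of v and has a finite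
  integral. Hence no \<infinity> - \<infinity> arises, even if u has infinite integral.\<close>

lemma ereal_integral_nn_plus_integrable:
  assumes u [measurable]: "u \<in> borel_measurable M" and v: "integrable M v"
  shows "ereal_integral M (\<lambda>x. enn2ereal (u x) + ereal (v x)) =
    enn2ereal (\<integral>\<^sup>+x. u x \<partial>M) + ereal (\<integral>x. v x \<partial>M)"
proof -
  let ?h = "\<lambda>x. enn2ereal (u x) + ereal (v x)"
  have [measurable]: "v \<in> borel_measurable M"
    using v by auto
  let ?P = "\<integral>\<^sup>+x. e2ennreal (?h x) \<partial>M" and ?N = "\<integral>\<^sup>+x. e2ennreal (- ?h x) \<partial>M"
  let ?p = "\<integral>\<^sup>+x. ennreal (v x) \<partial>M" and ?n = "\<integral>\<^sup>+x. ennreal (- v x) \<partial>M"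
  \<comment> \<open>The decomposition into positive and negative parts is arranged without
    subtraction, so it survives u(x) = \<infinity> and can be integrated term by term.\<close>
  have pt: "e2ennreal (?h x) + ennreal (- v x) = u x + ennreal (v x) + e2ennreal (- ?h x)" for x
    by (cases "u x") (auto simp: ennreal_plus_if e2ennreal_neg ennreal_neg simp flip: ennreal_plus)
  have "?P + ?n = (\<integral>\<^sup>+x. e2ennreal (?h x) + ennreal (- v x) \<partial>M)"
    by (rule nn_integral_add[symmetric]) measurable
  also have "\<dots> = (\<integral>\<^sup>+x. u x + ennreal (v x) + e2ennreal (- ?h x) \<partial>M)"
    by (simp only: pt)
  also have "\<dots> = (\<integral>\<^sup>+x. u x \<partial>M) + ?p + ?N"
    by (subst nn_integral_add; (subst nn_integral_add)?; (rule refl)?; measurable)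
  finally have eq: "?P + ?n = (\<integral>\<^sup>+x. u x \<partial>M) + ?p + ?N" .
  have "?N \<le> ?n"
  proof (rule nn_integral_mono)
    show "e2ennreal (- ?h x) \<le> ennreal (- v x)" for x
      by (cases "u x") (auto simp: e2ennreal_neg intro!: ennreal_leI)
  qed
  moreover have fin: "?n < \<infinity>" "?p < \<infinity>"
    using v unfolding real_integrable_def by (auto simp: less_top)
  ultimately have "?N < \<infinity>"
    by (metis le_less_trans)
  then obtain N n p where N: "?N = ennreal N" "N \<ge> 0" and n: "?n = ennreal n" "n \<ge> 0" and p: "?p = ennreal p" "p \<ge> 0"
    using fin by (cases ?N; cases ?n; cases ?p) auto
  have int: "(\<integral>x. v x \<partial>M) = p - n"
    using real_lebesgue_integral_def[OF v] n p by simp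
  show ?thesis
    unfolding ereal_integral_def int N(1) using eq unfolding N(1) n(1) p(1)
    by (cases ?P; cases "\<integral>\<^sup>+x. u x \<partial>M")
      (use N n p in \<open>auto simp: algebra_simps simp flip: ennreal_plus\<close>)
qed

section \<open>\<open>E_div\<close> in terms of densities\<close>

lemma bdd_above_E_div:
  assumes "prob_space \<mu>" "\<gamma> \<ge> 0"
  shows "bdd_above ((\<lambda>A. measure \<mu> A - \<gamma> * measure \<nu> A) ` sets \<mu>)"
proof (rule bdd_aboveI2)
  interpret prob_space \<mu> by fact
  show "measure \<mu> A - \<gamma> * measure \<nu> A \<le> 1" for A
    using prob_le_1[of A] mult_nonneg_nonneg[OF assms(2) measure_nonneg[of \<nu> A]] by linarith
qed

lemma E_div_upper:
  assumes "prob_space \<mu>" "\<gamma> \<ge> 0" "A \<in> sets \<mu>"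
  shows "measure \<mu> A - \<gamma> * measure \<nu> A \<le> E_div \<gamma> \<mu> \<nu>"
  unfolding E_div_def using assms by (intro cSUP_upper bdd_above_E_div)

lemma E_div_nonneg:
  assumes "prob_space \<mu>" "\<gamma> \<ge> 0"
  shows "E_div \<gamma> \<mu> \<nu> \<ge> 0"
  using E_div_upper[OF assms, of "{}" \<nu>] by simp

text \<open>The integral equals the value of the objective at the event p > \<gamma> q, which is one
  of the candidates in the supremum.\<close>

lemma nn_integral_density_excess_le_E_div:
  fixes p q :: "'a \<Rightarrow> real"
  assumes [measurable]: "p \<in> borel_measurable S" "q \<in> borel_measurable S"
    and nn: "\<And>x. p x \<ge> 0" "\<And>x. q x \<ge> 0" and "\<gamma> \<ge> 0"
    and P: "prob_space (density S p)" and Q: "prob_space (density S q)"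
  shows "(\<integral>\<^sup>+x. ennreal (max 0 (p x - \<gamma> * q x)) \<partial>S) \<le> ennreal (E_div \<gamma> (density S p) (density S q))"
proof -
  interpret P: prob_space "density S p" by fact
  interpret Q: prob_space "density S q" by fact
  define A where "A = {x \<in> space S. p x > \<gamma> * q x}"
  have [measurable]: "A \<in> sets S"
    unfolding A_def by measurable
  \<comment> \<open>On \<open>A\<close> the density p is its excess plus \<gamma> q, and off
    \<open>A\<close> the excess is 0. The sum form postpones subtraction until all terms are
    finite.\<close>
  have "emeasure (density S p) A = (\<integral>\<^sup>+x. ennreal (max 0 (p x - \<gamma> * q x)) + ennreal \<gamma> * (ennreal (q x) * indicator A x) \<partial>S)"
    unfolding emeasure_density[OF measurable_compose[OF \<open>p \<in> borel_measurable S\<close> measurable_ennreal] \<open>A \<in> sets S\<close>]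
    using nn \<open>\<gamma> \<ge> 0\<close>
    by (intro nn_integral_cong) (auto simp: A_def indicator_def max_def simp flip: ennreal_mult ennreal_plus)
  also have "\<dots> = (\<integral>\<^sup>+x. ennreal (max 0 (p x - \<gamma> * q x)) \<partial>S) + ennreal \<gamma> * emeasure (density S q) A"
    by (simp add: nn_integral_add nn_integral_cmult emeasure_density)
  finally have eq: "ennreal (measure (density S p) A) =
      (\<integral>\<^sup>+x. ennreal (max 0 (p x - \<gamma> * q x)) \<partial>S) + ennreal (\<gamma> * measure (density S q) A)"
    using \<open>\<gamma> \<ge> 0\<close> by (simp add: P.emeasure_eq_measure Q.emeasure_eq_measure ennreal_mult)
  then have "(\<integral>\<^sup>+x. ennreal (max 0 (p x - \<gamma> * q x)) \<partial>S) = ennreal (measure (density S p) A - \<gamma> * measure (density S q) A)"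
    using \<open>\<gamma> \<ge> 0\<close> by (cases "\<integral>\<^sup>+x. ennreal (max 0 (p x - \<gamma> * q x)) \<partial>S") (auto simp flip: ennreal_plus)
  also have "\<dots> \<le> ennreal (E_div \<gamma> (density S p) (density S q))"
    using \<open>\<gamma> \<ge> 0\<close> P by (intro ennreal_leI E_div_upper) auto
  finally show ?thesis .
qed

section \<open>The divergence bounded by an integral of \<open>E_div\<close>\<close>

context convex_generator
begin

text \<open>The space is split into q > 0, where \<open>integrand_le\<close> applies pointwise, and
  q = 0, where \<open>slope_at_infinity_le\<close> bounds the singular term. The linear terms
  cancel, the two pieces recombine to the integral of \<open>density_gap\<close>, and Tonelli's
  theorem exchanges the integrals.\<close>

lemma f_divergence_le:
  assumes P: "prob_space P" and Q: "prob_space Q" and sets: "sets P = sets Q"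
  shows "f_divergence f P Q \<le>
    enn2ereal (\<integral>\<^sup>+\<gamma>. ennreal (weight \<gamma> * E_div \<gamma> P Q + weight' \<gamma> * E_div \<gamma> Q P) \<partial>lborel)"
proof -
  interpret P: prob_space P by fact
  interpret Q: prob_space Q by fact
  define S where "S = add_measure P Q"
  define p where "p x = enn2real (RN_deriv S P x)" for x
  define q where "q x = enn2real (RN_deriv S Q x)" for x
  have sets_S [simp, measurable_cong]: "sets S = sets P"
    unfolding S_def using sets by (rule sets_add_measure)
  have space_S [simp]: "space S = space P"
    unfolding S_def using sets by (rule space_add_measure)
  have emeasure_S: "emeasure S A = emeasure P A + emeasure Q A" if "A \<in> sets P" for A
    unfolding S_def using sets that by (rule emeasure_add_measure)
  have space_Q: "space Q = space P"
    using sets_eq_imp_space_eq[OF sets] by simp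
  interpret S: finite_measure S
  proof
    show "emeasure S (space S) \<noteq> \<infinity>"
      using emeasure_S[OF sets.top] P.emeasure_space_1 Q.emeasure_space_1 by (simp add: space_Q)
  qed
  have [measurable]: "p \<in> borel_measurable S" "q \<in> borel_measurable S"
    unfolding p_def q_def by (auto intro: measurable_compose[OF borel_measurable_RN_deriv])
  have nn [simp]: "p x \<ge> 0" "q x \<ge> 0" for x
    by (auto simp: p_def q_def)
  have ac: "absolutely_continuous S P" "absolutely_continuous S Q"
    using sets by (auto simp: absolutely_continuous_def null_sets_def emeasure_S)
  have dP: "density S p = P"
    unfolding p_def by (intro S.density_enn2real_RN_deriv P.finite_measure_axioms ac sets_S[symmetric])
  have dQ: "density S q = Q"
    unfolding q_def using sets
    by (intro S.density_enn2real_RN_deriv Q.finite_measure_axioms ac) (simp only: sets_S)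
  define A where "A = {x \<in> space S. q x > 0}"
  define B where "B = {x \<in> space S. q x = 0}"
  have [measurable]: "A \<in> sets S" "B \<in> sets S"
    unfolding A_def B_def by measurable
  then have [simp]: "A \<in> sets P" "B \<in> sets P"
    by simp_all
  have PA: "(\<integral>\<^sup>+x. ennreal (p x) * indicator X x \<partial>S) = ennreal (measure P X)" if "X \<in> sets S" for X
    using that emeasure_density[of p S X] by (simp add: dP P.emeasure_eq_measure)
  have QA: "(\<integral>\<^sup>+x. ennreal (q x) * indicator X x \<partial>S) = ennreal (measure Q X)" if "X \<in> sets S" for X
    using that emeasure_density[of q S X] by (simp add: dQ Q.emeasure_eq_measure)
  have intP: "has_bochner_integral S (\<lambda>x. p x * indicator X x) (measure P X)" if [measurable]: "X \<in> sets S" for X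
    using PA[OF that] by (intro has_bochner_integral_nn_integral) (auto simp: ennreal_mult' ennreal_indicator)
  have intQ: "has_bochner_integral S (\<lambda>x. q x * indicator X x) (measure Q X)" if [measurable]: "X \<in> sets S" for X
    using QA[OF that] by (intro has_bochner_integral_nn_integral) (auto simp: ennreal_mult' ennreal_indicator)
  have "(\<integral>\<^sup>+x. ennreal (q x) * indicator B x \<partial>S) = (\<integral>\<^sup>+x. 0 \<partial>S)"
    by (rule nn_integral_cong) (auto simp: B_def indicator_def)
  then have "measure Q B = 0"
    using QA[OF \<open>B \<in> sets S\<close>] by simp
  moreover have AB: "A \<inter> B = {}" "A \<union> B = space S"
    using nn by (auto simp: A_def B_def order.order_iff_strict)
  moreover have "measure P A + measure P B = measure P (A \<union> B)"
    using AB(1) \<open>A \<in> sets S\<close> \<open>B \<in> sets S\<close>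
    by (intro P.finite_measure_Union[symmetric]) simp_all
  moreover have "measure Q A + measure Q B = measure Q (A \<union> B)"
    using AB(1) \<open>A \<in> sets S\<close> \<open>B \<in> sets S\<close> unfolding sets_S sets
    by (intro Q.finite_measure_Union[symmetric]) simp_all
  moreover have "measure P (space S) = 1" "measure Q (space S) = 1"
    using P.prob_space Q.prob_space space_Q by simp_all
  ultimately have mA: "measure Q A = 1" "measure P A = 1 - measure P B"
    by simp_all
  define u where "u x = density_gap (p x) (q x)" for x
  have joint [measurable]: "(\<lambda>(x, \<gamma>). ennreal (weight \<gamma> * max 0 (p x - \<gamma> * q x) + weight' \<gamma> * max 0 (q x - \<gamma> * p x)))
      \<in> borel_measurable (S \<Otimes>\<^sub>M lborel)"
    by measurable
  have [measurable]: "u \<in> borel_measurable S"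
    unfolding u_def density_gap_def using lborel.borel_measurable_nn_integral[OF joint] by simp
  \<comment> \<open>The linear term is cut off to \<open>A\<close>, as the integrand of the
    divergence is 0 elsewhere. Its integral is \<open>f1 1\<close> times P(A) - Q(A), and this
    difference is -P(B) because Q(B) = 0.\<close>
  define v where "v x = f1 1 * (p x * indicator A x - q x * indicator A x)" for x
  have v: "has_bochner_integral S v (f1 1 * (measure P A - measure Q A))"
    unfolding v_def by (intro has_bochner_integral_mult_right has_bochner_integral_diff intP intQ) auto
  have "ereal_integral S (\<lambda>x. if q x > 0 then ereal (q x) * at_zero_ext f (p x / q x) else 0)
      \<le> ereal_integral S (\<lambda>x. enn2ereal (u x * indicator A x) + ereal (v x))"
  proof (rule ereal_integral_mono)
    fix x assume "x \<in> space S"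
    then show "(if q x > 0 then ereal (q x) * at_zero_ext f (p x / q x) else 0) \<le> enn2ereal (u x * indicator A x) + ereal (v x)"
      using integrand_le[of "p x" "q x"] by (auto simp: A_def u_def v_def zero_ennreal.rep_eq)
  qed
  also have "\<dots> = enn2ereal (\<integral>\<^sup>+x. u x * indicator A x \<partial>S) + ereal (- f1 1 * measure P B)"
    using v by (subst ereal_integral_nn_plus_integrable)
      (auto simp: has_bochner_integral_iff mA)
  finally have 1: "ereal_integral S (\<lambda>x. if q x > 0 then ereal (q x) * at_zero_ext f (p x / q x) else 0)
      \<le> enn2ereal (\<integral>\<^sup>+x. u x * indicator A x \<partial>S) + ereal (- f1 1 * measure P B)" .
  \<comment> \<open>On \<open>B\<close> the second density is 0, so homogeneity pulls out the
    constant \<open>density_gap 1 0\<close>.\<close>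
  have "(\<integral>\<^sup>+x. u x * indicator B x \<partial>S) = (\<integral>\<^sup>+x. density_gap 1 0 * (ennreal (p x) * indicator B x) \<partial>S)"
    using density_gap_cmult[of "p _" 1 0]
    by (intro nn_integral_cong) (auto simp: u_def B_def indicator_def mult.commute)
  also have "\<dots> = density_gap 1 0 * ennreal (measure P B)"
    by (simp add: nn_integral_cmult PA)
  finally have uB: "(\<integral>\<^sup>+x. u x * indicator B x \<partial>S) = density_gap 1 0 * ennreal (measure P B)" .
  have "slope_at_infinity f * ereal (measure P B) \<le> (enn2ereal (density_gap 1 0) + ereal (f1 1)) * ereal (measure P B)"
    using slope_at_infinity_le by (intro ereal_mult_right_mono) auto
  also have "\<dots> = enn2ereal (density_gap 1 0) * ereal (measure P B) + ereal (f1 1 * measure P B)"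
    by (subst ereal_distrib) auto
  also have "enn2ereal (density_gap 1 0) * ereal (measure P B) = enn2ereal (\<integral>\<^sup>+x. u x * indicator B x \<partial>S)"
    unfolding uB by (simp add: times_ennreal.rep_eq)
  finally have 2: "slope_at_infinity f * ereal (measure P B) \<le>
      enn2ereal (\<integral>\<^sup>+x. u x * indicator B x \<partial>S) + ereal (f1 1 * measure P B)" .
  have "f_divergence f P Q = ereal_integral S (\<lambda>x. if q x > 0 then ereal (q x) * at_zero_ext f (p x / q x) else 0)
      + slope_at_infinity f * ereal (measure P B)"
    by (simp add: f_divergence_def Let_def S_def[symmetric] p_def q_def B_def cong: if_cong)
  also have "\<dots> \<le> (enn2ereal (\<integral>\<^sup>+x. u x * indicator A x \<partial>S) + ereal (- f1 1 * measure P B))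
      + (enn2ereal (\<integral>\<^sup>+x. u x * indicator B x \<partial>S) + ereal (f1 1 * measure P B))"
    by (intro add_mono 1 2)
  \<comment> \<open>The two real corrections are opposite multiples of P(B) and cancel, also when
    one of the integrals is \<infinity>.\<close>
  also have "\<dots> = enn2ereal ((\<integral>\<^sup>+x. u x * indicator A x \<partial>S) + (\<integral>\<^sup>+x. u x * indicator B x \<partial>S))"
    unfolding plus_ennreal.rep_eq
    by (cases "enn2ereal (\<integral>\<^sup>+x. u x * indicator A x \<partial>S)"; cases "enn2ereal (\<integral>\<^sup>+x. u x * indicator B x \<partial>S)") auto
  also have "(\<integral>\<^sup>+x. u x * indicator A x \<partial>S) + (\<integral>\<^sup>+x. u x * indicator B x \<partial>S) = (\<integral>\<^sup>+x. u x \<partial>S)"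
    using AB by (subst nn_integral_add[symmetric]) (auto intro!: nn_integral_cong simp: indicator_def)
  also have "(\<integral>\<^sup>+x. u x \<partial>S) = (\<integral>\<^sup>+\<gamma>. \<integral>\<^sup>+x. ennreal (weight \<gamma> * max 0 (p x - \<gamma> * q x) + weight' \<gamma> * max 0 (q x - \<gamma> * p x)) \<partial>S \<partial>lborel)"
  proof -
    interpret pair_sigma_finite S lborel ..
    show ?thesis
      unfolding u_def density_gap_def using Fubini'[OF joint] by simp
  qed
  also have "\<dots> \<le> (\<integral>\<^sup>+\<gamma>. ennreal (weight \<gamma> * E_div \<gamma> P Q + weight' \<gamma> * E_div \<gamma> Q P) \<partial>lborel)"
  proof (rule nn_integral_mono)
    fix \<gamma> :: real
    show "(\<integral>\<^sup>+x. ennreal (weight \<gamma> * max 0 (p x - \<gamma> * q x) + weight' \<gamma> * max 0 (q x - \<gamma> * p x)) \<partial>S)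
        \<le> ennreal (weight \<gamma> * E_div \<gamma> P Q + weight' \<gamma> * E_div \<gamma> Q P)"
    proof (cases "\<gamma> \<ge> 1")
      case True
      have "(\<integral>\<^sup>+x. ennreal (weight \<gamma> * max 0 (p x - \<gamma> * q x) + weight' \<gamma> * max 0 (q x - \<gamma> * p x)) \<partial>S)
        = ennreal (weight \<gamma>) * (\<integral>\<^sup>+x. ennreal (max 0 (p x - \<gamma> * q x)) \<partial>S)
          + ennreal (weight' \<gamma>) * (\<integral>\<^sup>+x. ennreal (max 0 (q x - \<gamma> * p x)) \<partial>S)"
        by (simp add: nn_integral_add nn_integral_cmult ennreal_mult)
      also have "\<dots> \<le> ennreal (weight \<gamma>) * ennreal (E_div \<gamma> P Q) + ennreal (weight' \<gamma>) * ennreal (E_div \<gamma> Q P)"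
        using nn_integral_density_excess_le_E_div[of p S q \<gamma>] nn_integral_density_excess_le_E_div[of q S p \<gamma>] True P Q
        by (intro add_mono mult_left_mono) (auto simp: dP dQ)
      also have "\<dots> = ennreal (weight \<gamma> * E_div \<gamma> P Q + weight' \<gamma> * E_div \<gamma> Q P)"
        using E_div_nonneg[OF P, of \<gamma> Q] E_div_nonneg[OF Q, of \<gamma> P] True by (simp add: ennreal_mult)
      finally show ?thesis .
    qed (auto simp: weight_def weight'_def)
  qed
  finally show ?thesis
    by (simp add: less_eq_ennreal.rep_eq)
qed

end

section \<open>Contraction under the kernel\<close>

text \<open>If \<open>E_div\<close> of the inputs is nonzero, their ratio is a candidate in the
  supremum defining the coefficient. Otherwise the coefficient says nothing about this pair, and the
  left side is shown to be 0 directly.\<close>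

lemma E_div_bind_le:
  assumes mu: "\<mu> \<in> space (prob_algebra M)" and nu: "\<nu> \<in> space (prob_algebra M)"
    and K: "K \<in> M \<rightarrow>\<^sub>M prob_algebra N" and "\<gamma> \<ge> 0"
  shows "ennreal (E_div \<gamma> (\<mu> \<bind> K) (\<nu> \<bind> K)) \<le> contraction_coeff \<gamma> M K * ennreal (E_div \<gamma> \<mu> \<nu>)"
proof (cases "E_div \<gamma> \<mu> \<nu> = 0")
  case True
  interpret mu: prob_space \<mu> using mu by (simp add: space_prob_algebra)
  interpret nu: prob_space \<nu> using nu by (simp add: space_prob_algebra)
  have sets_mu [measurable_cong]: "sets \<mu> = sets M" and sets_nu [measurable_cong]: "sets \<nu> = sets M"
    using mu nu by (auto simp: space_prob_algebra)
  have b: "\<mu> \<bind> K \<in> space (prob_algebra N)" "\<nu> \<bind> K \<in> space (prob_algebra N)"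
    using sets_bind'[OF mu K] prob_space_bind'[OF mu K] sets_bind'[OF nu K] prob_space_bind'[OF nu K]
    by (auto simp: space_prob_algebra)
  interpret muK: prob_space "\<mu> \<bind> K" using b by (simp add: space_prob_algebra)
  interpret nuK: prob_space "\<nu> \<bind> K" using b by (simp add: space_prob_algebra)
  \<comment> \<open>A vanishing \<open>E_div\<close> means \<mu>(A) \<le> \<gamma> \<nu>(A) for
    every event. As an inequality of measures this passes through the integral against the
    kernel.\<close>
  have le: "\<mu> \<le> scale_measure (ennreal \<gamma>) \<nu>"
  proof (subst le_measure)
    show "\<forall>A\<in>sets \<mu>. emeasure \<mu> A \<le> emeasure (scale_measure (ennreal \<gamma>) \<nu>) A"
      using E_div_upper[OF mu.prob_space_axioms \<open>\<gamma> \<ge> 0\<close>, of _ \<nu>] True \<open>\<gamma> \<ge> 0\<close>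
      by (auto simp: mu.emeasure_eq_measure nu.emeasure_eq_measure ennreal_leI simp flip: ennreal_mult)
  qed (simp add: sets_mu sets_nu)
  have "E_div \<gamma> (\<mu> \<bind> K) (\<nu> \<bind> K) \<le> 0"
    unfolding E_div_def
  proof (rule cSUP_least)
    fix A assume "A \<in> sets (\<mu> \<bind> K)"
    then have A [measurable]: "A \<in> sets N"
      using b by (simp add: space_prob_algebra)
    have [measurable]: "(\<lambda>x. emeasure (K x) A) \<in> borel_measurable M"
      using measurable_emeasure_subprob_algebra[OF A] measurable_prob_algebraD[OF K]
      by (rule measurable_compose[rotated])
    have "emeasure (\<mu> \<bind> K) A = (\<integral>\<^sup>+x. emeasure (K x) A \<partial>\<mu>)"
      using mu K A by (rule emeasure_bind_prob_algebra)
    also have "\<dots> \<le> (\<integral>\<^sup>+x. emeasure (K x) A \<partial>scale_measure (ennreal \<gamma>) \<nu>)"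
      using le by (intro nn_integral_mono_measure) (simp_all add: sets_mu sets_nu)
    also have "\<dots> = ennreal \<gamma> * (\<integral>\<^sup>+x. emeasure (K x) A \<partial>\<nu>)"
      by (rule nn_integral_scale_measure) measurable
    also have "(\<integral>\<^sup>+x. emeasure (K x) A \<partial>\<nu>) = emeasure (\<nu> \<bind> K) A"
      using nu K A by (rule emeasure_bind_prob_algebra[symmetric])
    finally show "measure (\<mu> \<bind> K) A - \<gamma> * measure (\<nu> \<bind> K) A \<le> 0"
      using \<open>\<gamma> \<ge> 0\<close> by (simp add: muK.emeasure_eq_measure nuK.emeasure_eq_measure flip: ennreal_mult)
  qed auto
  then show ?thesis
    by (simp add: ennreal_neg)
next
  case False
  then have pos: "E_div \<gamma> \<mu> \<nu> > 0"
    using E_div_nonneg[of \<mu> \<gamma> \<nu>] mu \<open>\<gamma> \<ge> 0\<close> by (simp add: space_prob_algebra)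
  have "ennreal (E_div \<gamma> (\<mu> \<bind> K) (\<nu> \<bind> K) / E_div \<gamma> \<mu> \<nu>) \<le> contraction_coeff \<gamma> M K"
    unfolding contraction_coeff_def using mu nu False by (intro SUP_upper2[of "(\<mu>, \<nu>)"]) auto
  then have "ennreal (E_div \<gamma> (\<mu> \<bind> K) (\<nu> \<bind> K) / E_div \<gamma> \<mu> \<nu>) * ennreal (E_div \<gamma> \<mu> \<nu>)
      \<le> contraction_coeff \<gamma> M K * ennreal (E_div \<gamma> \<mu> \<nu>)"
    by (rule mult_right_mono) simp
  then show ?thesis
    using pos by (simp flip: ennreal_mult'')
qed

theorem corollary1:
  fixes f :: "real \<Rightarrow> real"
    and D :: "'a::euclidean_space set" and W :: "'b::euclidean_space set"
    and K :: "'a \<Rightarrow> 'b measure" and \<mu> \<nu> :: "'a measure"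
  assumes f_diff: "\<And>x. x > 0 \<Longrightarrow> f differentiable at x"
    and f_diff2: "\<And>x. x > 0 \<Longrightarrow> deriv f differentiable at x"
    and f_convex: "convex_on {0<..} f"
    and f_1: "f 1 = 0"
    and K: "K \<in> restrict_space borel D \<rightarrow>\<^sub>M prob_algebra (restrict_space borel W)"
    and mu: "\<mu> \<in> space (prob_algebra (restrict_space borel D))"
    and nu: "\<nu> \<in> space (prob_algebra (restrict_space borel D))"
  shows "f_divergence f (\<mu> \<bind> K) (\<nu> \<bind> K) \<le>
    enn2ereal (\<integral>\<^sup>+\<gamma>\<in>{1..}. contraction_coeff \<gamma> (restrict_space borel D) K *
       ennreal (deriv (deriv f) \<gamma> * E_div \<gamma> \<mu> \<nu> +
                deriv (deriv f) (1 / \<gamma>) / \<gamma> ^ 3 * E_div \<gamma> \<nu> \<mu>) \<partial>lborel)"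
proof -
  interpret convex_generator f
    using f_diff f_diff2 f_convex f_1 by unfold_locales
  let ?M = "restrict_space borel D" and ?P = "\<mu> \<bind> K" and ?Q = "\<nu> \<bind> K"
  have prob: "prob_space ?P" "prob_space ?Q" "sets ?P = sets ?Q"
    using mu nu K by (auto simp: prob_space_bind' sets_bind')
  have prob': "prob_space \<mu>" "prob_space \<nu>"
    using mu nu by (auto simp: space_prob_algebra)
  have "f_divergence f ?P ?Q \<le>
      enn2ereal (\<integral>\<^sup>+\<gamma>. ennreal (weight \<gamma> * E_div \<gamma> ?P ?Q + weight' \<gamma> * E_div \<gamma> ?Q ?P) \<partial>lborel)"
    using prob by (rule f_divergence_le)
  also have "\<dots> \<le> enn2ereal (\<integral>\<^sup>+\<gamma>\<in>{1..}. contraction_coeff \<gamma> ?M K *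
       ennreal (f2 \<gamma> * E_div \<gamma> \<mu> \<nu> + f2 (1 / \<gamma>) / \<gamma> ^ 3 * E_div \<gamma> \<nu> \<mu>) \<partial>lborel)"
    unfolding less_eq_ennreal.rep_eq[symmetric]
  proof (rule nn_integral_mono)
    fix \<gamma> :: real
    let ?c = "contraction_coeff \<gamma> ?M K"
    show "ennreal (weight \<gamma> * E_div \<gamma> ?P ?Q + weight' \<gamma> * E_div \<gamma> ?Q ?P) \<le>
        ?c * ennreal (f2 \<gamma> * E_div \<gamma> \<mu> \<nu> + f2 (1 / \<gamma>) / \<gamma> ^ 3 * E_div \<gamma> \<nu> \<mu>) * indicator {1..} \<gamma>"
    proof (cases "\<gamma> \<ge> 1")
      case True
      note nn = E_div_nonneg[OF prob(1), of \<gamma> ?Q] E_div_nonneg[OF prob(2), of \<gamma> ?P]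
        E_div_nonneg[OF prob'(1), of \<gamma> \<nu>] E_div_nonneg[OF prob'(2), of \<gamma> \<mu>]
      have "ennreal (weight \<gamma> * E_div \<gamma> ?P ?Q + weight' \<gamma> * E_div \<gamma> ?Q ?P) =
          ennreal (weight \<gamma>) * ennreal (E_div \<gamma> ?P ?Q) + ennreal (weight' \<gamma>) * ennreal (E_div \<gamma> ?Q ?P)"
        using nn True by (simp add: ennreal_mult)
      \<comment> \<open>The coefficient is a supremum over ordered pairs, so the same
        \<open>?c\<close> covers the inputs in both orders and can be factored out.\<close>
      also have "\<dots> \<le> ennreal (weight \<gamma>) * (?c * ennreal (E_div \<gamma> \<mu> \<nu>)) + ennreal (weight' \<gamma>) * (?c * ennreal (E_div \<gamma> \<nu> \<mu>))"
        using True by (intro add_mono mult_left_mono E_div_bind_le[OF mu nu K] E_div_bind_le[OF nu mu K]) auto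
      also have "\<dots> = ?c * ennreal (weight \<gamma> * E_div \<gamma> \<mu> \<nu> + weight' \<gamma> * E_div \<gamma> \<nu> \<mu>)"
        using nn True by (simp add: ennreal_mult algebra_simps)
      finally show ?thesis
        using True by (simp add: weight_def weight'_def)
    qed (auto simp: weight_def weight'_def)
  qed
  finally show ?thesis .
qed

end
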